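(* Let $n>1$ be an odd integer with $n\not\equiv 3 \pmod{12}$. Then there exists a harmonious integer sequence $k_0,k_1,\ldots,k_{n-1}$ that is harmoniously matched with some rearrangement $k_1',k_2',\ldots,k_{n-1}'$ of its nonzero terms and that satisfies $k_0+k_1+\cdots+k_{n-1}=0$ (as integers).
   Context: A harmonious integer sequence (of length $n$) is a sequence $k_0,k_1,\ldots,k_{n-1}$ of integers such that for all $i,j\in\{0,1,\ldots,n-1\}$ with $i\neq j$ one has both $k_i\not\equiv k_j \pmod n$ and $k_i+k_{i+1}\not\equiv k_j+k_{j+1}\pmod n$, where $k_n=k_0$. A harmonious integer sequence $k_0,k_1,\ldots,k_{n-1}$ is harmoniously matched with an integer sequence $k_1',k_2',\ldots,k_{n-1}'$ if $k_1',\ldots,k_{n-1}'$ is a rearrangement of the nonzero terms of $k_0,\ldots,k_{n-1}$ (so exactly one of the $k_i$ is the integer $0$), $k_0=k_1'$, $k_{n-1}=k_{n-1}'$, and the following equality of sets of integers holds: $$\{k_0+k_1,\,k_1+k_2,\,\ldots,\,k_{n-1}+k_0\}=\{0\}\cup\{k_1'+k_2',\,k_2'+k_3',\,\ldots,\,k_{n-1}'+k_1'\}.$$ *)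

theory Defs
  imports "HOL-Number_Theory.Number_Theory" "HOL-Library.Multiset"
begin

(* A sequence k_0, ..., k_{n-1} is a function of which only the values at the indices
   i < n matter; reducing the successor index modulo n encodes the convention k_n = k_0. *)

definition harmonious :: "nat \<Rightarrow> (nat \<Rightarrow> int) \<Rightarrow> bool" where
  "harmonious n k \<longleftrightarrow>
     (\<forall>i<n. \<forall>j<n. i \<noteq> j \<longrightarrow>
        \<not> [k i = k j] (mod int n) \<and>
        \<not> [k i + k ((i + 1) mod n) = k j + k ((j + 1) mod n)] (mod int n))"

(* Only the values k' 1, ..., k' (n - 1) matter. The cyclic successor of the index n - 1
   in {1..<n} is 1. The multiset equation says that k'_1, ..., k'_{n-1} is a rearrangement
   of the nonzero terms of k; comparing sizes, it forces exactly one k_i to be 0. *)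

definition harmoniously_matched :: "nat \<Rightarrow> (nat \<Rightarrow> int) \<Rightarrow> (nat \<Rightarrow> int) \<Rightarrow> bool" where
  "harmoniously_matched n k k' \<longleftrightarrow>
     harmonious n k \<and>
     {#k' i. i \<in># mset_set {1..<n}#} = {#x \<in># {#k i. i \<in># mset_set {0..<n}#}. x \<noteq> 0#} \<and>
     k 0 = k' 1 \<and>
     k (n - 1) = k' (n - 1) \<and>
     {k i + k ((i + 1) mod n) | i. i \<in> {0..<n}} =
       {0} \<union> {k' i + k' (if i = n - 1 then 1 else i + 1) | i. i \<in> {1..<n}}"

end

theory Submission
  imports Defs
begin

text \<open>
  Write \<open>n = 2 * m + 1\<close>. The terms of \<open>k\<close> are the integers from \<open>- m\<close> to \<open>m\<close>, so they are distinct
  modulo \<open>n\<close> and sum to zero. Both sequences are built from one positive half and a common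
  negative half.

  Let \<open>P\<close> be an ordering of \<open>1, ..., m\<close> that starts with \<open>1\<close> and ends with some \<open>\<alpha>\<close>. The cycle \<open>k\<close>
  consists of \<open>0\<close>, then \<open>P\<close>, then the negated reversal of \<open>P\<close>, which runs from \<open>- \<alpha>\<close> to \<open>- 1\<close>. Its
  sums are those of \<open>P\<close>, their negatives, and \<open>1, 0, - 1\<close> at the three joins. Now let \<open>P'\<close> be another
  ordering of \<open>1, ..., m\<close> with the same set \<open>S\<close> of adjacent sums, starting with \<open>2\<close> and ending with
  \<open>\<alpha> - 1\<close>. Replacing \<open>0\<close> and \<open>P\<close> by \<open>P'\<close> gives the cycle \<open>k'\<close>, whose joins contribute
  \<open>- 1 + 2 = 1\<close> and \<open>(\<alpha> - 1) - \<alpha> = - 1\<close>, so that exactly the sum \<open>0\<close> is lost. Cutting both cycles at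
  the same edge of the negative half makes their end terms agree. The cycle \<open>k\<close> is harmonious as soon
  as no two elements of \<open>{1} \<union> S\<close> add up to \<open>n\<close>. This is \<open>matched_from_paths\<close>.

  It remains to find \<open>P\<close> and \<open>P'\<close>. The condition on \<open>S\<close> holds when \<open>{1} \<union> S\<close> consists of the odd
  numbers below \<open>2 * m\<close>, since \<open>n\<close> is odd, and it stays true when one odd number \<open>2 * r + 1\<close> is
  traded for the even number \<open>n - (2 * r + 1)\<close> (\<open>matched_from_missing_odd\<close>).

  \<^item> For even \<open>m\<close>, the orderings \<open>1, 2, ..., m\<close> and \<open>2, 1, 4, 3, ..., m, m - 1\<close> both have all odd numbers
    from \<open>3\<close> to \<open>2 * m - 1\<close> as their sums.

  \<^item> For odd \<open>m\<close> this is impossible: if all sums are odd, even and odd terms alternate,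
    and the ends \<open>1\<close>, \<open>\<alpha>\<close> of \<open>P\<close> are then odd, while the end \<open>2\<close> of \<open>P'\<close> is not. So one odd sum has to
    be traded. A jump from \<open>a\<close> to \<open>m\<close> in \<open>1, ..., a, m, m - 1, ..., a + 1\<close> trades \<open>2 * a + 1\<close>
    for \<open>a + m\<close>; the trade is the permitted one exactly if \<open>m = 3 * a\<close>. The same jump from the last
    term \<open>b - 1\<close> of \<open>2, 1, 4, 3, ..., b, b - 1\<close> requires \<open>m = 3 * b - 1\<close>. With \<open>m\<close> odd these
    are the cases \<open>m mod 6 = 3\<close> and \<open>m mod 6 = 5\<close>, which leave out only \<open>m mod 6 = 1\<close>, that is,
    \<open>n mod 12 = 3\<close>. In either case the partner ordering has to be found; it is easy for
    \<open>m = 3 * a\<close> (\<open>matched_third\<close>) and needs a braided middle part for \<open>m = 3 * b - 1\<close>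
    (\<open>dense_path\<close>), with the exceptions \<open>b = 6\<close> and \<open>b = 2\<close> given by explicit lists.
\<close>

section \<open>Sums of adjacent list entries\<close>

fun adj_sums :: "int list \<Rightarrow> int multiset" where
  "adj_sums (x # y # zs) = add_mset (x + y) (adj_sums (y # zs))"
| "adj_sums _ = {#}"

lemma adj_sums_append:
  "xs \<noteq> [] \<Longrightarrow> ys \<noteq> [] \<Longrightarrow>
   adj_sums (xs @ ys) = add_mset (last xs + hd ys) (adj_sums xs + adj_sums ys)"
proof (induction xs rule: adj_sums.induct)
  case ("2_2" v)
  then show ?case by (cases ys) auto
qed auto

lemma adj_sums_rev: "adj_sums (rev xs) = adj_sums xs"
proof (induction xs rule: adj_sums.induct)
  case (1 x y zs)
  have "adj_sums (rev (x # y # zs)) = adj_sums (rev (y # zs) @ [x])" by simp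
  also have "\<dots> = add_mset (y + x) (adj_sums (rev (y # zs)))"
    by (subst adj_sums_append) (auto simp: last_rev)
  finally show ?case using 1 by (simp add: add.commute)
qed auto

lemma adj_sums_uminus: "adj_sums (map uminus xs) = image_mset uminus (adj_sums xs)"
  by (induction xs rule: adj_sums.induct) auto

section \<open>Cyclic sequences as lists\<close>

definition cyclic_sums :: "int list \<Rightarrow> int list" where
  "cyclic_sums xs = map2 (+) xs (rotate1 xs)"

lemma mset_cyclic_sums:
  assumes "xs \<noteq> []"
  shows "mset (cyclic_sums xs) = add_mset (last xs + hd xs) (adj_sums xs)"
proof -
  have "mset (map2 (+) (x # ys) (ys @ [z])) = add_mset (last (x # ys) + z) (adj_sums (x # ys))" for x z ys
    by (induction ys arbitrary: x) auto
  then show ?thesis using assms by (cases xs) (auto simp: cyclic_sums_def)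
qed

lemma nth_cyclic_sums:
  "i < length xs \<Longrightarrow> cyclic_sums xs ! i = xs ! i + xs ! ((i + 1) mod length xs)"
  by (simp add: cyclic_sums_def nth_rotate1)

lemma length_cyclic_sums [simp]: "length (cyclic_sums xs) = length xs"
  by (simp add: cyclic_sums_def)

definition distinct_mod :: "int \<Rightarrow> int list \<Rightarrow> bool" where
  "distinct_mod n xs \<longleftrightarrow> distinct (map (\<lambda>x. x mod n) xs)"

lemma harmonious_nth:
  assumes "distinct_mod (length xs) xs" and "distinct_mod (length xs) (cyclic_sums xs)"
  shows "harmonious (length xs) ((!) xs)"
  using assms
  unfolding harmonious_def distinct_mod_def cong_def
  by (auto simp: distinct_conv_nth nth_cyclic_sums)

text \<open>
  The sequence \<open>k'\<close> is indexed from \<open>1\<close>, whence the shift \<open>ys ! (i - 1)\<close>; the successor of an index in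
  \<open>ys\<close>, taken modulo \<open>n - 1\<close>, then agrees with the convention that \<open>1\<close> follows \<open>n - 1\<close>.
\<close>

lemma harmoniously_matched_nth:
  assumes k: "harmonious (length xs) ((!) xs)"
    and ne: "ys \<noteq> []"
    and rearr: "mset ys = {#x \<in># mset xs. x \<noteq> 0#}"
    and ends: "hd xs = hd ys" "last xs = last ys" and len: "length xs = length ys + 1"
    and sums: "set (cyclic_sums xs) = insert 0 (set (cyclic_sums ys))"
  shows "harmoniously_matched (length xs) ((!) xs) (\<lambda>i. ys ! (i - 1))"
proof -
  define n where "n = length xs"
  have n: "n = length ys + 1" "n > 1" using len ne by (auto simp: n_def)
  have xs_ne: "xs \<noteq> []" using n by (auto simp: n_def)
  have "{#ys ! (i - 1). i \<in># mset_set {1..<n}#} = mset (map (\<lambda>i. ys ! (i - 1)) [1..<n])"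
    by (simp only: mset_map mset_upt)
  also have "map (\<lambda>i. ys ! (i - 1)) [1..<n] = ys"
    by (rule nth_equalityI) (auto simp: n nth_upt simp del: upt_Suc)
  finally have 1: "{#ys ! (i - 1). i \<in># mset_set {1..<n}#} = mset ys" .
  have 2: "{#xs ! i. i \<in># mset_set {0..<n}#} = mset xs"
    by (metis map_nth mset_map mset_upt n_def)
  have 3: "{xs ! i + xs ! ((i + 1) mod n) | i. i \<in> {0..<n}} = set (cyclic_sums xs)"
    by (auto simp: set_conv_nth n_def nth_cyclic_sums) (metis nth_cyclic_sums One_nat_def add.commute plus_1_eq_Suc)+
  have wrap: "ys ! (i - 1) + ys ! ((if i = n - 1 then 1 else i + 1) - 1) = cyclic_sums ys ! (i - 1)"
    if "i \<in> {1..<n}" for i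
  proof -
    have "(i - 1 + 1) mod length ys = (if i = n - 1 then 1 else i + 1) - 1"
      using that n by auto
    then show ?thesis using that n by (subst nth_cyclic_sums) auto
  qed
  have "{ys ! (i - 1) + ys ! ((if i = n - 1 then 1 else i + 1) - 1) | i. i \<in> {1..<n}}
      = (\<lambda>i. cyclic_sums ys ! (i - 1)) ` {1..<n}"
    unfolding Setcompr_eq_image by (rule image_cong[OF refl]) (use wrap in auto)
  also have "\<dots> = (!) (cyclic_sums ys) ` ((\<lambda>i. i - 1) ` {1..<n})" by (simp add: image_image)
  also have "(\<lambda>i. i - 1) ` {1..<n} = {0..<length ys}"
  proof -
    have "i \<in> (\<lambda>i. i - 1) ` {1..<n}" if "i < length ys" for i
      using that n by (intro image_eqI[of _ _ "i + 1"]) auto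
    then show ?thesis using n by auto
  qed
  also have "(!) (cyclic_sums ys) ` {0..<length ys} = set (cyclic_sums ys)"
    by (metis length_cyclic_sums list.set_map map_nth set_upt)
  finally have 4: "{ys ! (i - 1) + ys ! ((if i = n - 1 then 1 else i + 1) - 1) | i. i \<in> {1..<n}}
      = set (cyclic_sums ys)" .
  have 5: "xs ! 0 = ys ! 0" "xs ! (n - 1) = ys ! (n - 1 - 1)"
    using ends xs_ne ne n by (simp_all add: hd_conv_nth last_conv_nth n_def)
  show ?thesis
    unfolding harmoniously_matched_def n_def[symmetric] 1 2 3 4
    using k rearr sums 5 by (simp add: n_def)
qed

section \<open>Matched cycles from two orderings of the positive half\<close>

lemma distinct_mod_mset_set:
  assumes "mset xs = mset_set A" "finite A" "\<And>x y. x \<in> A \<Longrightarrow> y \<in> A \<Longrightarrow> n dvd x - y \<Longrightarrow> x = y"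
  shows "distinct_mod n xs"
proof -
  have "set xs = A" using assms(1,2) by (metis finite_set_mset_mset_set set_mset_mset)
  moreover have "distinct xs" using assms(1,2)
    by (metis \<open>set xs = A\<close> distinct_count_atmost_1 count_mset_set(1) count_mset_set(3))
  ultimately show ?thesis
    unfolding distinct_mod_def distinct_map using assms(3) by (auto simp: inj_on_def mod_eq_dvd_iff)
qed

lemma dvd_small_int: "n dvd x \<Longrightarrow> \<bar>x\<bar> < n \<Longrightarrow> x = 0" for n x :: int
  using dvd_imp_le_int[of x n] by fastforce

definition zero_sum_matched :: "nat \<Rightarrow> bool" where
  "zero_sum_matched n \<longleftrightarrow> (\<exists>k k' :: nat \<Rightarrow> int.
     harmonious n k \<and> harmoniously_matched n k k' \<and> (\<Sum>i = 0..<n. k i) = 0)"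

text \<open>
  The cycles described at the beginning: a shared negative half, completed by \<open>0\<close> and \<open>P\<close> in one case
  and by \<open>P'\<close> in the other. The set of sums of the first is \<open>{0} \<union> T \<union> - T\<close> with \<open>T = {1} \<union> S\<close>. Two
  sums of equal sign are closer than \<open>n\<close>, so only a pair of opposite signs, \<open>u\<close> and \<open>- v\<close>, could be
  congruent, and then \<open>u + v\<close>, which lies strictly between \<open>0\<close> and \<open>2 * n\<close>, would equal \<open>n\<close>.
\<close>

lemma matched_from_paths:
  fixes m :: nat and P P' :: "int list" and S :: "int set"
  assumes m: "m \<ge> 2"
    and P: "mset P = mset_set {1..int m}" "hd P = 1" "last P = \<alpha>"
    and P': "mset P' = mset_set {1..int m}" "hd P' = 2" "last P' = \<alpha> - 1"
    and S: "adj_sums P = mset_set S" "adj_sums P' = mset_set S" "S \<subseteq> {2..2 * int m}"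
    and anti: "\<And>x y. x \<in> insert 1 S \<Longrightarrow> y \<in> insert 1 S \<Longrightarrow> x + y \<noteq> 2 * int m + 1"
  shows "zero_sum_matched (2 * m + 1)"
proof -
  have finS: "finite S" using S(3) finite_subset by blast
  have lenP: "length P = m" "length P' = m"
    using arg_cong[OF P(1), of size] arg_cong[OF P'(1), of size] by simp_all
  define Q where "Q = butlast P"
  have PQ: "P = Q @ [\<alpha>]" using m lenP P(3) unfolding Q_def
    by (metis append_butlast_last_id list.size(3) not_numeral_le_zero)
  have Q_ne: "Q \<noteq> []" using PQ lenP m by auto
  have hdQ: "hd Q = 1" using P(2) PQ Q_ne by simp
  have P'_ne: "P' \<noteq> []" using lenP m by auto
  define N where "N = map uminus (rev Q)"
  have N_ne: "N \<noteq> []" using Q_ne by (simp add: N_def)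
  have lastN: "last N = - 1" using Q_ne hdQ by (simp add: N_def last_map last_rev)
  have hdN: "hd N = - last Q" using Q_ne by (simp add: N_def hd_map hd_rev)
  have adjP: "adj_sums P = add_mset (last Q + \<alpha>) (adj_sums Q)"
    unfolding PQ using Q_ne by (simp add: adj_sums_append)
  have adjN: "adj_sums N = image_mset uminus (adj_sums Q)"
    by (simp add: N_def adj_sums_uminus adj_sums_rev)
  \<comment> \<open>Both cycles are cut between \<open>- \<alpha>\<close> and its successor \<open>- last Q\<close> in the negative half.\<close>
  define xs where "xs = N @ 0 # P @ [- \<alpha>]"
  define ys where "ys = N @ P' @ [- \<alpha>]"
  have cxs: "mset (cyclic_sums xs) = add_mset 0 (image_mset uminus (add_mset 1 (mset_set S)) + add_mset 1 (mset_set S))"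
  proof -
    have "adj_sums xs = add_mset (- 1) (add_mset 1 (add_mset 0 (adj_sums N + adj_sums P)))"
      unfolding xs_def using N_ne PQ Q_ne hdQ lastN
      by (simp add: adj_sums_append[of N] adj_sums_append[of "[0]" "_ @ _", simplified] adj_sums_append[of _ "[_]"] adj_sums_append[of Q])
    then show ?thesis
      using N_ne hdN by (subst mset_cyclic_sums)
        (auto simp: xs_def S(1)[symmetric] adjN adjP)
  qed
  have cys: "mset (cyclic_sums ys) = image_mset uminus (add_mset 1 (mset_set S)) + add_mset 1 (mset_set S)"
  proof -
    have "adj_sums ys = add_mset 1 (add_mset (- 1) (adj_sums N + adj_sums P'))"
      unfolding ys_def using N_ne P'_ne lastN P'
      by (simp add: adj_sums_append)
    then show ?thesis
      using N_ne hdN by (subst mset_cyclic_sums)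
        (auto simp: ys_def S(2) S(1)[symmetric] adjN adjP)
  qed
  define T where "T = insert 1 S"
  have one: "1 \<notin> S" using S(3) by auto
  have Tpos: "x > 0" if "x \<in> T" for x using that S(3) by (auto simp: T_def)
  have Tle: "x \<le> 2 * int m" if "x \<in> T" for x using that S(3) m by (auto simp: T_def)
  have finT: "finite T" using finS by (simp add: T_def)
  have T: "add_mset 1 (mset_set S) = mset_set T" using finS one by (simp add: T_def)
  have opposite: "- x \<notin> T" if "x \<in> T" for x using Tpos[of x] Tpos[of "- x"] that by auto
  have zero: "0 \<notin> T" using Tpos by blast
  have cxs': "mset (cyclic_sums xs) = mset_set (insert 0 (uminus ` T \<union> T))"
  proof -
    have "image_mset uminus (mset_set T) = mset_set (uminus ` T)"
      by (rule image_mset_mset_set) auto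
    moreover have "uminus ` T \<inter> T = {}" using opposite by blast
    moreover have "0 \<notin> uminus ` T \<union> T" using zero by auto
    ultimately show ?thesis unfolding cxs T using finT by (simp add: mset_set_Union)
  qed
  have msxs: "mset xs = mset_set {- int m..int m}"
  proof -
    have "mset xs = add_mset 0 (image_mset uminus (mset P) + mset P)"
      by (simp add: xs_def N_def PQ)
    also have "\<dots> = mset_set (insert 0 (uminus ` {1..int m} \<union> {1..int m}))"
    proof -
      have "image_mset uminus (mset_set {1..int m}) = mset_set (uminus ` {1..int m})"
        by (rule image_mset_mset_set) auto
      moreover have "uminus ` {1..int m} \<inter> {1..int m} = {}" by auto
      moreover have "0 \<notin> uminus ` {1..int m} \<union> {1..int m}" by auto
      ultimately show ?thesis unfolding P(1) by (simp add: mset_set_Union)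
    qed
    also have "insert 0 (uminus ` {1..int m} \<union> {1..int m}) = {- int m..int m}" by auto
    finally show ?thesis .
  qed
  have len: "length xs = 2 * m + 1" "length ys = 2 * m"
    using lenP m PQ by (auto simp: xs_def ys_def N_def)
  have h: "harmonious (2 * m + 1) ((!) xs)"
    unfolding len(1)[symmetric]
  proof (rule harmonious_nth)
    show "distinct_mod (int (length xs)) xs"
    proof (rule distinct_mod_mset_set[OF msxs])
      fix x y :: int
      assume "x \<in> {- int m..int m}" "y \<in> {- int m..int m}" "int (length xs) dvd x - y"
      then show "x = y" using dvd_small_int[of "int (length xs)" "x - y"] len by auto
    qed simp
    show "distinct_mod (int (length xs)) (cyclic_sums xs)"
    proof (rule distinct_mod_mset_set[OF cxs'])
      fix x y :: int
      assume xy: "x \<in> insert 0 (uminus ` T \<union> T)" "y \<in> insert 0 (uminus ` T \<union> T)"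
        and dvd: "int (length xs) dvd x - y"
      have n: "int (length xs) = 2 * int m + 1" using len by simp
      have same: "x = y" if "x \<in> insert 0 T \<and> y \<in> insert 0 T \<or> - x \<in> insert 0 T \<and> - y \<in> insert 0 T"
      proof -
        have "0 \<le> u \<and> u \<le> 2 * int m" if "u \<in> insert 0 T" for u
          using that Tpos[of u] Tle[of u] by auto
        from that this[of x] this[of y] this[of "- x"] this[of "- y"]
        have "\<bar>x - y\<bar> < int (length xs)" unfolding n by linarith
        with dvd have "x - y = 0" by (rule dvd_small_int)
        then show ?thesis by simp
      qed
      have opp: False if uv: "u \<in> T" "v \<in> T" and dvd_uv: "2 * int m + 1 dvd u + v" for u v
      proof -
        have "2 * int m + 1 dvd u + v - (2 * int m + 1)" using dvd_uv by simp
        moreover have "\<bar>u + v - (2 * int m + 1)\<bar> < 2 * int m + 1"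
          using uv[THEN Tpos] uv[THEN Tle] by simp
        ultimately have "u + v - (2 * int m + 1) = 0" by (rule dvd_small_int)
        then show False using anti[of u v] uv by (simp add: T_def)
      qed
      consider "x \<in> insert 0 T \<and> y \<in> insert 0 T \<or> - x \<in> insert 0 T \<and> - y \<in> insert 0 T"
        | "x \<in> T" "- y \<in> T" | "- x \<in> T" "y \<in> T"
        using xy by (auto simp: image_iff)
      then show "x = y"
      proof cases
        case 2
        then show ?thesis using opp[of x "- y"] dvd n by simp
      next
        case 3
        have "2 * int m + 1 dvd - x + y" using dvd n by (metis dvd_minus_iff minus_diff_eq diff_conv_add_uminus add.commute)
        then show ?thesis using opp[OF 3] by simp
      qed (rule same)
    qed (use finT in simp)
  qed
  have "harmoniously_matched (length xs) ((!) xs) (\<lambda>i. ys ! (i - 1))"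
  proof (rule harmoniously_matched_nth)
    show "harmonious (length xs) ((!) xs)" using h len by simp
    show "ys \<noteq> []" by (simp add: ys_def)
    show "hd xs = hd ys" "last xs = last ys" using N_ne by (simp_all add: xs_def ys_def)
    show "length xs = length ys + 1" using len by simp
    have "set (cyclic_sums xs) = set_mset (mset (cyclic_sums xs))" by simp
    also have "\<dots> = insert 0 (set_mset (mset (cyclic_sums ys)))"
      unfolding cxs cys by simp
    finally show "set (cyclic_sums xs) = insert 0 (set (cyclic_sums ys))" by simp
    have "mset ys = image_mset uminus (mset P) + mset P"
    proof -
      have "mset P' = mset P" using P(1) P'(1) by simp
      then show ?thesis by (simp add: ys_def N_def PQ)
    qed
    moreover have "{#x \<in># mset P. x \<noteq> 0#} = mset P"
      by (rule filter_mset_cong0[of _ _ "\<lambda>_. True", simplified filter_mset_True]) (auto simp: P(1))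
    moreover have "mset xs = add_mset 0 (image_mset uminus (mset P) + mset P)"
      by (simp add: xs_def N_def PQ)
    ultimately show "mset ys = {#x \<in># mset xs. x \<noteq> 0#}"
      by (simp add: filter_mset_image_mset)
  qed
  moreover have "(\<Sum>i = 0..<2 * m + 1. xs ! i) = 0"
  proof -
    have "(\<Sum>i = 0..<2 * m + 1. xs ! i) = sum_list xs" using len by (simp add: sum_list_sum_nth)
    also have "\<dots> = sum_list (map uminus Q) + sum_list Q"
      by (simp add: xs_def N_def PQ flip: rev_map)
    also have "\<dots> = 0" by (induction Q) auto
    finally show ?thesis .
  qed
  ultimately show ?thesis using h len unfolding zero_sum_matched_def by metis
qed

section \<open>Orderings with odd sums\<close>

text \<open>
  The odd numbers \<open>2 * i + 1 = i + (i + 1)\<close> with \<open>a \<le> i < b\<close>. Indexed in this way they are the sums of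
  the straight run from \<open>a\<close> to \<open>b\<close>, and half-open ranges concatenate as runs do.
\<close>

definition odds :: "int \<Rightarrow> int \<Rightarrow> int multiset" where
  "odds a b = mset_set ((\<lambda>i. 2 * i + 1) ` {a..<b})"

lemma odds_empty [simp]: "b \<le> a \<Longrightarrow> odds a b = {#}"
  by (simp add: odds_def)

lemma odds_append: "a \<le> b \<Longrightarrow> b \<le> c \<Longrightarrow> odds a b + odds b c = odds a c"
  unfolding odds_def
  by (subst mset_set_Union[symmetric]) (auto simp: image_Un[symmetric] ivl_disj_un)

lemma odds_Suc: "odds a (a + 1) = {#2 * a + 1#}"
proof -
  have "{a..<a + 1} = {a}" by auto
  then show ?thesis by (simp add: odds_def)
qed

lemma odds_first: "a < b \<Longrightarrow> odds a b = add_mset (2 * a + 1) (odds (a + 1) b)"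
  using odds_append[of a "a + 1" b] by (simp add: odds_Suc)

lemma odds_last: "a \<le> b \<Longrightarrow> odds a (b + 1) = add_mset (2 * b + 1) (odds a b)"
  using odds_append[of a b "b + 1"] by (simp add: odds_Suc)

lemma adj_sums_upto: "a \<le> b \<Longrightarrow> adj_sums [a..b] = odds a b"
proof (induction b rule: int_ge_induct)
  case (step b)
  have "adj_sums ([a..b] @ [b + 1]) = odds a (b + 1)"
    using step by (subst adj_sums_append) (simp_all add: odds_last last_conv_nth)
  then show ?case using step by (simp add: upto_rec2)
qed simp

lemma hd_upto [simp]: "a \<le> b \<Longrightarrow> hd [a..b] = a"
  by (simp add: upto_rec1)

lemma last_upto [simp]: "a \<le> b \<Longrightarrow> last [a..b] = b"
  by (simp add: upto_rec2)

lemma mset_upto: "mset [a..b] = mset_set {a..b}"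
  using mset_set_set[of "[a..b]"] by simp

lemma mset_set_upto_split:
  "a \<le> b + 1 \<Longrightarrow> b \<le> c \<Longrightarrow> mset_set {a..c} = mset_set {a..b} + mset_set {b + 1..c::int}"
  by (subst mset_set_Union[symmetric]) (auto intro!: arg_cong[of _ _ mset_set])

lemma mset_set_pair: "b = a + 1 \<Longrightarrow> mset_set {a..b::int} = {#a, b#}"
  using mset_upto[of a b] by (simp add: upto_rec1)

text \<open>
  The run \<open>2, 1, 4, 3, ...\<close> of swapped pairs has the same sums as the straight run. It is stated
  as a prefix of a list \<open>ys\<close> that starts where the next pair would start, so that the empty run is
  covered: there the value \<open>hd (xs @ ys) = 2\<close> comes from \<open>ys\<close>.
\<close>

lemma swap_prefix:
  fixes t :: nat
  assumes "ys \<noteq> []" and "hd ys = 2 * int t + 2"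
  shows "\<exists>xs. mset xs = mset_set {1..2 * int t} \<and> hd (xs @ ys) = 2 \<and>
           adj_sums (xs @ ys) = odds 1 (2 * int t + 1) + adj_sums ys"
  using assms
proof (induction t arbitrary: ys)
  case 0
  then show ?case by (intro exI[of _ "[]"]) simp
next
  case (Suc t)
  let ?zs = "[2 * int t + 2, 2 * int t + 1] @ ys"
  obtain xs where xs: "mset xs = mset_set {1..2 * int t}" "hd (xs @ ?zs) = 2"
      "adj_sums (xs @ ?zs) = odds 1 (2 * int t + 1) + adj_sums ?zs"
    using Suc.IH[of ?zs] by auto
  have "adj_sums ?zs = odds (2 * int t + 1) (2 * int t + 3) + adj_sums ys"
    using Suc.prems odds_first[of "2 * int t + 1" "2 * int t + 3"]
      odds_first[of "2 * int t + 2" "2 * int t + 3"]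
    by (subst adj_sums_append) (simp_all add: ac_simps)
  then have "adj_sums (xs @ ?zs) = odds 1 (2 * int (Suc t) + 1) + adj_sums ys"
    using xs(3) odds_append[of 1 "2 * int t + 1" "2 * int t + 3"] by (simp add: algebra_simps)
  moreover have "mset (xs @ [2 * int t + 2, 2 * int t + 1]) = mset_set {1..2 * int (Suc t)}"
  proof -
    have "mset_set {1..2 * int t + 2} = mset_set {1..2 * int t} + mset [2 * int t + 1..2 * int t + 2]"
      unfolding mset_upto by (rule mset_set_upto_split) auto
    then show ?thesis using xs(1) by (simp add: upto_rec1 algebra_simps)
  qed
  ultimately show ?case using xs(2)
    by (intro exI[of _ "xs @ [2 * int t + 2, 2 * int t + 1]"]) simp
qed

text \<open>
  An ordering of \<open>p + 1, p + 3, p + 4, ..., p + b\<close>, with \<open>p + 2\<close> left out, whose sums are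
  consecutive odd numbers. It ends at \<open>p + b - 3\<close>, so a descending block
  \<open>p + b + 4, ..., p + b + 1\<close> can be attached: the join has the sum \<open>2 * (p + b) + 1\<close>, the
  smallest of the four new sums, and the block ends three below its maximum again. Hence
  starting lists for \<open>b = 4\<close> and \<open>b = 10\<close> suffice. For \<open>b = 6\<close> first and last entry would coincide.
\<close>

lemma dense_path:
  fixes p :: int
  assumes "even b" "b \<ge> 4" "b \<noteq> (6::nat)"
  shows "\<exists>xs. xs \<noteq> [] \<and> add_mset (p + 2) (mset xs) = mset_set {p + 1..p + int b} \<and> hd xs = p + 3 \<and>
           last xs = p + int b - 3 \<and> adj_sums xs = odds (p + 2) (p + int b)"
  using assms
proof (induction b rule: less_induct)
  case (less b)
  consider "b = 4" | "b = 10" | "b \<ge> 8" "b \<noteq> 10"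
    using less.prems by (elim evenE) force
  then show ?case
  proof cases
    case 1
    have "odds (p + 2) (p + 4) = {#2 * p + 5, 2 * p + 7#}"
      by (simp add: odds_first ac_simps)
    moreover have "mset_set {p + 1..p + 4} = {#p + 1, p + 2, p + 3, p + 4#}"
      unfolding mset_upto[symmetric] by (simp add: upto_rec1 ac_simps)
    ultimately show ?thesis using 1
      by (intro exI[of _ "[p + 3, p + 4, p + 1]"]) (simp add: ac_simps)
  next
    case 2
    have "odds (p + 2) (p + 10) = {#2 * p + 5, 2 * p + 7, 2 * p + 9, 2 * p + 11, 2 * p + 13, 2 * p + 15, 2 * p + 17, 2 * p + 19#}"
      by (simp add: odds_first ac_simps)
    moreover have "mset_set {p + 1..p + 10} = {#p + 1, p + 2, p + 3, p + 4, p + 5, p + 6, p + 7, p + 8, p + 9, p + 10#}"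
      unfolding mset_upto[symmetric] by (simp add: upto_rec1 ac_simps)
    ultimately show ?thesis using 2
      by (intro exI[of _ "[p + 3, p + 4, p + 1, p + 8, p + 5, p + 6, p + 9, p + 10, p + 7]"]) (simp add: ac_simps)
  next
    case 3
    define c where "c = b - 4"
    have c: "b = c + 4" "even c" "c \<ge> 4" "c \<noteq> 6" using 3 less.prems by (auto simp: c_def)
    obtain xs where xs: "xs \<noteq> []" "add_mset (p + 2) (mset xs) = mset_set {p + 1..p + int c}" "hd xs = p + 3"
        "last xs = p + int c - 3" "adj_sums xs = odds (p + 2) (p + int c)"
      using less.IH[of c] c by auto
    let ?q = "p + int c"
    let ?ys = "[?q + 4, ?q + 3, ?q + 2, ?q + 1]"
    have "odds ?q (?q + 4) = {#2 * ?q + 1, 2 * ?q + 3, 2 * ?q + 5, 2 * ?q + 7#}"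
      by (simp add: odds_first ac_simps)
    then have "odds (p + 2) (?q + 4) = odds (p + 2) ?q + {#2 * ?q + 1, 2 * ?q + 3, 2 * ?q + 5, 2 * ?q + 7#}"
      using odds_append[of "p + 2" ?q "?q + 4"] c by simp
    moreover have "mset_set {p + 1..?q + 4} = mset_set {p + 1..?q} + {#?q + 1, ?q + 2, ?q + 3, ?q + 4#}"
      using mset_set_upto_split[of "p + 1" ?q "?q + 4"]
      unfolding mset_upto[symmetric] by (simp add: upto_rec1 ac_simps)
    ultimately show ?thesis using xs c
      by (intro exI[of _ "xs @ ?ys"]) (simp add: adj_sums_append algebra_simps)
  qed
qed

section \<open>The families of orderings\<close>

text \<open>
  The sum \<open>2 * r + 1\<close> is traded for \<open>n - (2 * r + 1) = 2 * (m - r)\<close>. Two numbers that add up to the odd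
  number \<open>n\<close> have different parities, so one of them is the new even sum and the other the
  missing odd one.
\<close>

lemma matched_from_missing_odd:
  fixes m r :: nat
  assumes r: "1 \<le> r" "r < m"
    and P: "mset P = mset_set {1..int m}" "hd P = 1" "last P = \<alpha>"
    and P': "mset P' = mset_set {1..int m}" "hd P' = 2" "last P' = \<alpha> - 1"
    and S: "adj_sums P = add_mset (2 * (int m - int r)) (odds 1 (int r) + odds (int r + 1) (int m))"
           "adj_sums P' = add_mset (2 * (int m - int r)) (odds 1 (int r) + odds (int r + 1) (int m))"
  shows "zero_sum_matched (2 * m + 1)"
proof -
  define I where "I = {1..<int r} \<union> {int r + 1..<int m}"
  define S where "S = insert (2 * (int m - int r)) ((\<lambda>i. 2 * i + 1) ` I)"
  have "odds 1 (int r) + odds (int r + 1) (int m) = mset_set ((\<lambda>i. 2 * i + 1) ` I)"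
    unfolding odds_def I_def image_Un
    by (rule mset_set_Union[symmetric]) auto
  moreover have "2 * (int m - int r) \<notin> (\<lambda>i. 2 * i + 1) ` I" by (auto, presburger)
  ultimately have eq: "add_mset (2 * (int m - int r)) (odds 1 (int r) + odds (int r + 1) (int m)) = mset_set S"
    unfolding S_def by (simp add: I_def)
  have "insert 1 S = insert (2 * (int m - int r)) ((\<lambda>i. 2 * i + 1) ` (insert 0 I))"
    by (auto simp: S_def)
  moreover have "int r \<notin> insert 0 I" using r by (auto simp: I_def)
  ultimately have anti: "x + y \<noteq> 2 * int m + 1" if "x \<in> insert 1 S" "y \<in> insert 1 S" for x y
    using that by (auto simp del: insert_iff simp: insert_iff[of _ "2 * _"]) presburger+
  show ?thesis
  proof (rule matched_from_paths[OF _ P P'])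
    show "adj_sums P = mset_set S" "adj_sums P' = mset_set S" using S eq by simp_all
    show "S \<subseteq> {2..2 * int m}" using r by (auto simp: S_def I_def)
  qed (use r anti in auto)
qed

lemma matched_even:
  assumes s: "m = 2 * s + 2"
  shows "zero_sum_matched (2 * m + 1)"
proof -
  let ?M = "int m"
  obtain xs where xs: "mset xs = mset_set {1..2 * int s}" "hd (xs @ [?M, ?M - 1]) = 2"
      "adj_sums (xs @ [?M, ?M - 1]) = odds 1 (2 * int s + 1) + adj_sums [?M, ?M - 1]"
    using swap_prefix[of "[?M, ?M - 1]" s] s by auto
  show ?thesis
  proof (rule matched_from_paths[where S = "(\<lambda>i. 2 * i + 1) ` {1..<?M}"])
    show "m \<ge> 2" using s by simp
    show "mset [1..?M] = mset_set {1..?M}" by (rule mset_upto)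
    show "hd [1..?M] = 1" "last [1..?M] = ?M" using s by simp_all
    show "hd (xs @ [?M, ?M - 1]) = 2" "last (xs @ [?M, ?M - 1]) = ?M - 1" using xs by simp_all
    show "mset (xs @ [?M, ?M - 1]) = mset_set {1..?M}"
      using xs(1) s mset_set_upto_split[of 1 "2 * int s" "2 * int s + 2"]
      by (simp add: mset_set_pair ac_simps)
    show "adj_sums [1..?M] = mset_set ((\<lambda>i. 2 * i + 1) ` {1..<?M})"
      using s by (simp add: adj_sums_upto odds_def)
    show "adj_sums (xs @ [?M, ?M - 1]) = mset_set ((\<lambda>i. 2 * i + 1) ` {1..<?M})"
      using s odds_last[of 1 "2 * int s + 1"] unfolding xs(3) odds_def[symmetric]
      by (simp add: algebra_simps)
    show "(\<lambda>i. 2 * i + 1) ` {1..<?M} \<subseteq> {2..2 * ?M}" by auto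
    show "x + y \<noteq> 2 * ?M + 1"
      if "x \<in> insert 1 ((\<lambda>i. 2 * i + 1) ` {1..<?M})" "y \<in> insert 1 ((\<lambda>i. 2 * i + 1) ` {1..<?M})" for x y
      using that by (auto, presburger+)
  qed
qed

text \<open>
  The two orderings are \<open>1, ..., a, m, m - 1, ..., a + 1\<close> and
  \<open>2, 1, 4, 3, ..., a - 1, a - 2, a + 1, a + 2, ..., m, a\<close>. Both make a jump between \<open>a\<close> and \<open>m\<close>, of sum
  \<open>a + m = 2 * (m - a)\<close>, in place of the step of sum \<open>2 * a + 1\<close>. The oddness of \<open>a\<close> is what lets the
  swapped pairs exhaust the numbers below \<open>a\<close>.
\<close>

lemma matched_third:
  assumes m: "m = 3 * a" and a: "a = 2 * t + 1"
  shows "zero_sum_matched (2 * m + 1)"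
proof -
  let ?M = "int m" and ?a = "int a"
  let ?ys = "[?a + 1..?M] @ [?a]"
  have le: "?a + 1 \<le> ?M" "1 \<le> ?a" using m a by simp_all
  obtain xs where xs: "mset xs = mset_set {1..2 * int t}" "hd (xs @ ?ys) = 2"
      "adj_sums (xs @ ?ys) = odds 1 (2 * int t + 1) + adj_sums ?ys"
    using swap_prefix[of ?ys t] le a by auto
  show ?thesis
  proof (rule matched_from_missing_odd[where r = a])
    show "1 \<le> a" "a < m" using m a by simp_all
    show "mset ([1..?a] @ rev [?a + 1..?M]) = mset_set {1..?M}"
      using le mset_set_upto_split[of 1 ?a ?M] by (simp add: mset_upto)
    show "hd ([1..?a] @ rev [?a + 1..?M]) = 1" "last ([1..?a] @ rev [?a + 1..?M]) = ?a + 1"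
      using le by (simp_all add: last_rev)
    show "hd (xs @ ?ys) = 2" "last (xs @ ?ys) = ?a + 1 - 1" using xs by simp_all
    show "mset (xs @ ?ys) = mset_set {1..?M}"
      using le a xs(1) mset_set_upto_split[of 1 "?a - 1" ?M] mset_set_upto_split[of ?a ?a ?M]
      by (simp add: mset_upto ac_simps)
    show "adj_sums ([1..?a] @ rev [?a + 1..?M]) = add_mset (2 * (?M - ?a)) (odds 1 ?a + odds (?a + 1) ?M)"
      using le m by (simp add: adj_sums_append hd_rev adj_sums_rev adj_sums_upto)
    show "adj_sums (xs @ ?ys) = add_mset (2 * (?M - ?a)) (odds 1 ?a + odds (?a + 1) ?M)"
      unfolding xs(3) using le m a by (simp add: adj_sums_append adj_sums_upto algebra_simps)
  qed
qed

text \<open>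
  The part of \<open>P\<close> that follows the straight run \<open>1, ..., b\<close> when \<open>m = 3 * b - 1\<close>. It passes through
  \<open>b + 1, ..., 2 * b\<close> without \<open>b + 2\<close>, reaching \<open>2 * b - 3\<close>, jumps to \<open>2 * b + 1\<close> with the required even sum
  \<open>4 * b - 2\<close>, climbs to \<open>m\<close>, and closes with the reserved \<open>b + 2\<close>; the final sum
  \<open>m + b + 2 = 2 * (2 * b) + 1\<close> is the odd number that the jump skipped.
  For \<open>b = 6\<close>, where \<open>dense_path\<close> has no list, the one given was found by search.
\<close>

lemma tail_path:
  fixes b :: nat
  assumes "even b" "b \<ge> 4"
  defines "m \<equiv> 3 * int b - 1"
  shows "\<exists>xs. xs \<noteq> [] \<and> mset xs = mset_set {int b + 1..m} \<and> hd xs = int b + 3 \<and> last xs = int b + 2 \<and>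
           adj_sums xs = add_mset (2 * (m - int b)) (odds (int b + 2) m)"
proof (cases "b = 6")
  case True
  have "odds 8 17 = {#17, 19, 21, 23, 25, 27, 29, 31, 33#}"
    by (simp add: odds_first)
  moreover have "mset_set {7..17::int} = {#7, 8, 9, 10, 11, 12, 13, 14, 15, 16, 17#}"
    unfolding mset_upto[symmetric] by (simp add: upto_rec1)
  ultimately show ?thesis using True
    by (intro exI[of _ "[9, 13, 12, 15, 14, 17, 16, 7, 10, 11, 8]"]) (simp add: m_def)
next
  case False
  let ?b = "int b"
  obtain xs where xs: "xs \<noteq> []" "add_mset (?b + 2) (mset xs) = mset_set {?b + 1..?b + ?b}" "hd xs = ?b + 3"
      "last xs = ?b + ?b - 3" "adj_sums xs = odds (?b + 2) (?b + ?b)"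
    using dense_path[of b ?b] assms False by auto
  let ?zs = "xs @ [2 * ?b + 1..m] @ [?b + 2]"
  have le: "2 * ?b + 1 \<le> m" using assms by simp
  have "mset ?zs = mset_set {?b + 1..m}"
    using xs(2) mset_set_upto_split[of "?b + 1" "2 * ?b" m] le by (simp add: mset_upto algebra_simps)
  moreover have "adj_sums ?zs = add_mset (2 * (m - ?b)) (odds (?b + 2) m)"
  proof -
    have "odds (?b + 2) m = add_mset (m + ?b + 2) (odds (?b + 2) (2 * ?b) + odds (2 * ?b + 1) m)"
      using odds_append[of "?b + 2" "2 * ?b" m] odds_first[of "2 * ?b" m] assms
      by (simp add: ac_simps)
    then show ?thesis
      using xs le by (simp add: adj_sums_append adj_sums_upto m_def ac_simps)
  qed
  ultimately show ?thesis using xs by (intro exI[of _ ?zs]) simp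
qed

text \<open>
  Here \<open>P'\<close> is \<open>2, 1, 4, 3, ..., b, b - 1, m, m - 1, ..., b + 1\<close>, whose jump has the sum
  \<open>b - 1 + m = 2 * (m - b)\<close>, and \<open>P\<close> is \<open>1, ..., b\<close> followed by the list of \<open>tail_path\<close>, joined with the
  sum \<open>b + (b + 3) = 2 * (b + 1) + 1\<close>.
\<close>

lemma matched_minus_third:
  assumes m: "m + 1 = 3 * b" and b: "b = 2 * t + 4"
  shows "zero_sum_matched (2 * m + 1)"
proof -
  let ?M = "int m" and ?b = "int b"
  have M: "?M = 3 * ?b - 1" using m by simp
  let ?ys = "[?b, ?b - 1] @ rev [?b + 1..?M]"
  have le: "?b + 1 \<le> ?M" "1 \<le> ?b" using m b by simp_all
  obtain xs where xs: "mset xs = mset_set {1..2 * int (t + 1)}" "hd (xs @ ?ys) = 2"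
      "adj_sums (xs @ ?ys) = odds 1 (2 * int (t + 1) + 1) + adj_sums ?ys"
    using swap_prefix[of ?ys "t + 1"] b by auto
  obtain zs where zs: "zs \<noteq> []" "mset zs = mset_set {?b + 1..?M}" "hd zs = ?b + 3" "last zs = ?b + 2"
      "adj_sums zs = add_mset (2 * (?M - ?b)) (odds (?b + 2) ?M)"
    using tail_path[of b] b unfolding M by auto
  show ?thesis
  proof (rule matched_from_missing_odd[where r = b])
    show "1 \<le> b" "b < m" using m b by simp_all
    show "mset ([1..?b] @ zs) = mset_set {1..?M}"
      using le zs(2) mset_set_upto_split[of 1 ?b ?M] by (simp add: mset_upto)
    show "hd ([1..?b] @ zs) = 1" "last ([1..?b] @ zs) = ?b + 2"
      using le zs by simp_all
    show "hd (xs @ ?ys) = 2" "last (xs @ ?ys) = ?b + 2 - 1" using xs le by (simp_all add: last_rev)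
    show "mset (xs @ ?ys) = mset_set {1..?M}"
    proof -
      have "mset_set {1..?b} = mset_set {1..?b - 2} + {#?b - 1, ?b#}"
        using mset_set_upto_split[of 1 "?b - 2" ?b] b
        by (simp add: mset_set_pair ac_simps)
      then show ?thesis
        using le b xs(1) mset_set_upto_split[of 1 ?b ?M] by (simp add: mset_upto)
    qed
    show "adj_sums ([1..?b] @ zs) = add_mset (2 * (?M - ?b)) (odds 1 ?b + odds (?b + 1) ?M)"
      using le zs m b odds_first[of "?b + 1" ?M]
      by (simp add: adj_sums_append adj_sums_upto ac_simps)
    show "adj_sums (xs @ ?ys) = add_mset (2 * (?M - ?b)) (odds 1 ?b + odds (?b + 1) ?M)"
    proof -
      have "adj_sums ?ys = add_mset (2 * ?b - 1) (add_mset (?b - 1 + ?M) (odds (?b + 1) ?M))"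
        using le by (subst adj_sums_append) (simp_all add: hd_rev adj_sums_rev adj_sums_upto)
      also have "?b - 1 + ?M = 2 * (?M - ?b)" using M by simp
      finally show ?thesis
        unfolding xs(3) using b odds_last[of 1 "?b - 1"] by (simp add: ac_simps)
    qed
  qed
qed

text \<open>
  For \<open>m = 5\<close> no trade of a single odd number works. The sums \<open>4, 6, 8, 9\<close> together with \<open>1\<close> contain
  exactly one of \<open>x\<close> and \<open>11 - x\<close> for every \<open>x\<close> from \<open>1\<close> to \<open>5\<close>.
\<close>

lemma matched_eleven: "zero_sum_matched 11"
proof -
  have "mset_set {1..5::int} = {#1, 2, 3, 4, 5#}"
    unfolding mset_upto[symmetric] by (simp add: upto_rec1)
  moreover have "x + y \<noteq> 11" if "x \<in> {1, 4, 6, 8, 9}" "y \<in> {1, 4, 6, 8, 9}" for x y :: int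
    using that by auto
  ultimately show ?thesis
    using matched_from_paths[of 5 "[1, 3, 5, 4, 2]" 2 "[2, 4, 5, 3, 1]" "{4, 6, 8, 9}"] by simp
qed

theorem theorem4:
  fixes n :: nat
  assumes "n > 1" and "odd n" and "\<not> [n = 3] (mod 12)"
  shows "\<exists>k k' :: nat \<Rightarrow> int.
           harmonious n k \<and> harmoniously_matched n k k' \<and> (\<Sum>i = 0..<n. k i) = 0"
proof -
  obtain m where n: "n = 2 * m + 1" using \<open>odd n\<close> by (elim oddE)
  have "m mod 6 \<noteq> 1"
  proof
    assume "m mod 6 = 1"
    then have "n mod 12 = 3" unfolding n by presburger
    then show False using assms(3) by (simp add: cong_def)
  qed
  then have "even m \<or> m mod 6 = 3 \<or> m = 5 \<or> m mod 6 = 5 \<and> m > 5"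
    by presburger
  then consider "even m" | "m mod 6 = 3" | "m = 5" | "m mod 6 = 5" "m > 5"
    by blast
  then have "zero_sum_matched n"
  proof cases
    case 1
    then have "m = 2 * (m div 2 - 1) + 2" using \<open>n > 1\<close> n by presburger
    then show ?thesis using matched_even n by blast
  next
    case 2
    then have "m = 3 * (2 * (m div 6) + 1)" by presburger
    then show ?thesis using matched_third n by blast
  next
    case 3
    then show ?thesis using matched_eleven n by simp
  next
    case 4
    then have "m + 1 = 3 * (2 * (m div 6 - 1) + 4)" by presburger
    then show ?thesis using matched_minus_third n by blast
  qed
  then show ?thesis unfolding zero_sum_matched_def .
qed

end
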